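(* Let $(G,X)$ be a $G$-system with $G$ a discrete infinite amenable group and $(X,d)$ a compact metric space, let $\mathcal{F}$ be a F{\o}lner net in $G$, and let $x\in X$. If $\mathcal{C}_{\mathcal{F}}(x)$ is S-generic and is not itself a minimal subset of $(G,X)$, then there exists an F-chaotic pair $(y,z)$ with $y,z\in\mathcal{C}_{\mathcal{F}}(x)$.
   Context: A $G$-system $(G,X)$: $G$ is a discrete infinite amenable group with identity $e$, $(X,d)$ is a compact metric space, and $G$ acts on $X$ from the left by continuous transformations ($ex=x$, $(gf)x=g(fx)$). A set $\Lambda\subseteq X$ is $G$-invariant if $g\Lambda\subseteq\Lambda$ for all $g\in G$. A nonempty closed $G$-invariant set is minimal if the orbit of each of its points is dense in it. A (left) F{\o}lner net in $G$ is a net $\mathcal{F}=\{F_n\}_{n\in D}$ of (nonempty) finite subsets of $G$ with $\lim_{n\in D}|gF_n\vartriangle F_n|/|F_n|=0$ for all $g\in G$. For $A\subseteq G$, $\overline{d}_{\mathcal{F}}(A)=\sup\{\alpha \mid \forall m\in D\ \exists n\ge m:\ |A\cap F_n|/|F_n|\ge\alpha\}$ and $\underline{d}_{\mathcal{F}}(A)=\sup\{\alpha \mid \exists m\in D\ \forall n\ge m:\ |A\cap F_n|/|F_n|\ge\alpha\}$; if they coincide the common value is $d_{\mathcal{F}}(A)$. A closed set $C\subseteq X$ is an $\mathcal{F}$-center of attraction of $x$ if $d_{\mathcal{F}}(\{g\in G\mid gx\in B_\epsilon(C)\})=1$ for all $\epsilon>0$, where $B_\epsilon(C)$ is the $\epsilon$-neighborhood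 of $C$. The minimal one (no proper subset of which is an $\mathcal{F}$-center of attraction of $x$), which exists and is unique, is denoted $\mathcal{C}_{\mathcal{F}}(x)$. A $G$-invariant set $\Lambda\subseteq X$ is S-generic (relative to $\mathcal{F}$) if there is $y\in\Lambda$ with $\Lambda=\mathcal{C}_{\mathcal{F}}(y)$. For $y,z\in X$, $(y,z)$ is an F-chaotic pair if there are sequences $\{l_n\},\{r_n\},\{s_n\},\{t_n\}$ ($n\geq 1$) in $G$ such that $\lim_n d(l_ny,z)=0$, $\lim_n d(r_ny,z)>0$, $\lim_n d(s_ny,s_nz)=0$ and $\lim_n d(t_ny,t_nz)>0$ (all limits existing). *)

theory Defs
  imports "HOL-Analysis.Analysis" "HOL-Algebra.Group_Action"
begin

text \<open>Amenability of a discrete group: a left-invariant finitely additive probability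
  measure on all subsets.\<close>

definition amenable_group :: "('g, 'm) monoid_scheme \<Rightarrow> bool" where
  "amenable_group G \<longleftrightarrow> group G \<and>
     (\<exists>\<mu> :: 'g set \<Rightarrow> real.
        (\<forall>A. A \<subseteq> carrier G \<longrightarrow> 0 \<le> \<mu> A) \<and>
        \<mu> (carrier G) = 1 \<and>
        (\<forall>A B. A \<subseteq> carrier G \<longrightarrow> B \<subseteq> carrier G \<longrightarrow> A \<inter> B = {} \<longrightarrow>
           \<mu> (A \<union> B) = \<mu> A + \<mu> B) \<and>
        (\<forall>g A. g \<in> carrier G \<longrightarrow> A \<subseteq> carrier G \<longrightarrow> \<mu> (g <#\<^bsub>G\<^esub> A) = \<mu> A))"

text \<open>The phase space is the whole type \<open>'x\<close>. Only the group laws and continuity are asked of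
  the action; \<open>G\<close> carries no topology.\<close>

definition G_system :: "('g, 'm) monoid_scheme \<Rightarrow> ('g \<Rightarrow> 'x::metric_space \<Rightarrow> 'x) \<Rightarrow> bool" where
  "G_system G \<phi> \<longleftrightarrow>
     amenable_group G \<and> infinite (carrier G) \<and>
     compact (UNIV :: 'x set) \<and>
     group_action G (UNIV :: 'x set) \<phi> \<and>
     (\<forall>g\<in>carrier G. continuous_on UNIV (\<phi> g))"

definition G_invariant :: "('g, 'm) monoid_scheme \<Rightarrow> ('g \<Rightarrow> 'x \<Rightarrow> 'x) \<Rightarrow> 'x set \<Rightarrow> bool" where
  "G_invariant G \<phi> \<Lambda> \<longleftrightarrow> (\<forall>g\<in>carrier G. \<phi> g ` \<Lambda> \<subseteq> \<Lambda>)"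

definition minimal_subset ::
    "('g, 'm) monoid_scheme \<Rightarrow> ('g \<Rightarrow> 'x::metric_space \<Rightarrow> 'x) \<Rightarrow> 'x set \<Rightarrow> bool" where
  "minimal_subset G \<phi> \<Lambda> \<longleftrightarrow>
     \<Lambda> \<noteq> {} \<and> closed \<Lambda> \<and> G_invariant G \<phi> \<Lambda> \<and>
     (\<forall>z\<in>\<Lambda>. \<Lambda> \<subseteq> closure (orbit G \<phi> z))"

text \<open>A net is indexed by an arbitrary directed set \<open>D\<close>, preordered by \<open>R\<close>; limits along the
  net are limits along its filter of tails.\<close>

definition directed_set :: "'n set \<Rightarrow> ('n \<Rightarrow> 'n \<Rightarrow> bool) \<Rightarrow> bool" where
  "directed_set D R \<longleftrightarrow>
     D \<noteq> {} \<and> reflp_on D R \<and> transp_on D R \<and>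
     (\<forall>m\<in>D. \<forall>n\<in>D. \<exists>k\<in>D. R m k \<and> R n k)"

definition tail_filter :: "'n set \<Rightarrow> ('n \<Rightarrow> 'n \<Rightarrow> bool) \<Rightarrow> 'n filter" where
  "tail_filter D R = (INF m\<in>D. principal {n\<in>D. R m n})"

definition folner_net ::
    "('g, 'm) monoid_scheme \<Rightarrow> 'n set \<Rightarrow> ('n \<Rightarrow> 'n \<Rightarrow> bool) \<Rightarrow> ('n \<Rightarrow> 'g set) \<Rightarrow> bool" where
  "folner_net G D R F \<longleftrightarrow>
     directed_set D R \<and>
     (\<forall>n\<in>D. F n \<subseteq> carrier G \<and> finite (F n) \<and> F n \<noteq> {}) \<and>
     (\<forall>g\<in>carrier G.
        ((\<lambda>n. real (card (sym_diff (g <#\<^bsub>G\<^esub> F n) (F n))) / real (card (F n))) \<longlongrightarrow> 0)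
          (tail_filter D R))"

text \<open>For a Folner net, both suprema are over sets of reals that contain \<open>0\<close> and are bounded
  above by \<open>1\<close>, so \<open>Sup\<close> is the true supremum.\<close>

definition upper_density ::
    "'n set \<Rightarrow> ('n \<Rightarrow> 'n \<Rightarrow> bool) \<Rightarrow> ('n \<Rightarrow> 'g set) \<Rightarrow> 'g set \<Rightarrow> real" where
  "upper_density D R F A =
     Sup {\<alpha>. \<forall>m\<in>D. \<exists>n\<in>D. R m n \<and> real (card (A \<inter> F n)) / real (card (F n)) \<ge> \<alpha>}"

definition lower_density ::
    "'n set \<Rightarrow> ('n \<Rightarrow> 'n \<Rightarrow> bool) \<Rightarrow> ('n \<Rightarrow> 'g set) \<Rightarrow> 'g set \<Rightarrow> real" where
  "lower_density D R F A =
     Sup {\<alpha>. \<exists>m\<in>D. \<forall>n\<in>D. R m n \<longrightarrow> real (card (A \<inter> F n)) / real (card (F n)) \<ge> \<alpha>}"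

definition has_density ::
    "'n set \<Rightarrow> ('n \<Rightarrow> 'n \<Rightarrow> bool) \<Rightarrow> ('n \<Rightarrow> 'g set) \<Rightarrow> 'g set \<Rightarrow> real \<Rightarrow> bool" where
  "has_density D R F A \<delta> \<longleftrightarrow> upper_density D R F A = \<delta> \<and> lower_density D R F A = \<delta>"

definition center_of_attraction ::
    "('g, 'm) monoid_scheme \<Rightarrow> ('g \<Rightarrow> 'x::metric_space \<Rightarrow> 'x) \<Rightarrow>
     'n set \<Rightarrow> ('n \<Rightarrow> 'n \<Rightarrow> bool) \<Rightarrow> ('n \<Rightarrow> 'g set) \<Rightarrow> 'x \<Rightarrow> 'x set \<Rightarrow> bool" where
  "center_of_attraction G \<phi> D R F x C \<longleftrightarrow>
     closed C \<and>
     (\<forall>\<epsilon>>0. has_density D R F {g \<in> carrier G. \<phi> g x \<in> (\<Union>c\<in>C. ball c \<epsilon>)} 1)"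

text \<open>The definite description is justified: in a \<open>G\<close>-system with a Folner net the minimal center
  of attraction of \<open>x\<close> exists and is unique.\<close>

definition min_center ::
    "('g, 'm) monoid_scheme \<Rightarrow> ('g \<Rightarrow> 'x::metric_space \<Rightarrow> 'x) \<Rightarrow>
     'n set \<Rightarrow> ('n \<Rightarrow> 'n \<Rightarrow> bool) \<Rightarrow> ('n \<Rightarrow> 'g set) \<Rightarrow> 'x \<Rightarrow> 'x set" where
  "min_center G \<phi> D R F x =
     (THE C. center_of_attraction G \<phi> D R F x C \<and>
        (\<forall>C'. C' \<subset> C \<longrightarrow> \<not> center_of_attraction G \<phi> D R F x C'))"

definition S_generic ::
    "('g, 'm) monoid_scheme \<Rightarrow> ('g \<Rightarrow> 'x::metric_space \<Rightarrow> 'x) \<Rightarrow>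
     'n set \<Rightarrow> ('n \<Rightarrow> 'n \<Rightarrow> bool) \<Rightarrow> ('n \<Rightarrow> 'g set) \<Rightarrow> 'x set \<Rightarrow> bool" where
  "S_generic G \<phi> D R F \<Lambda> \<longleftrightarrow>
     G_invariant G \<phi> \<Lambda> \<and> (\<exists>y\<in>\<Lambda>. \<Lambda> = min_center G \<phi> D R F y)"

definition F_chaotic_pair ::
    "('g, 'm) monoid_scheme \<Rightarrow> ('g \<Rightarrow> 'x::metric_space \<Rightarrow> 'x) \<Rightarrow> 'x \<Rightarrow> 'x \<Rightarrow> bool" where
  "F_chaotic_pair G \<phi> y z \<longleftrightarrow>
     (\<exists>l r s t :: nat \<Rightarrow> 'g.
        range l \<subseteq> carrier G \<and> range r \<subseteq> carrier G \<and>
        range s \<subseteq> carrier G \<and> range t \<subseteq> carrier G \<and>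
        (\<lambda>n. dist (\<phi> (l n) y) z) \<longlonglongrightarrow> 0 \<and>
        (\<exists>a>0. (\<lambda>n. dist (\<phi> (r n) y) z) \<longlonglongrightarrow> a) \<and>
        (\<lambda>n. dist (\<phi> (s n) y) (\<phi> (s n) z)) \<longlonglongrightarrow> 0 \<and>
        (\<exists>b>0. (\<lambda>n. dist (\<phi> (t n) y) (\<phi> (t n) z)) \<longlonglongrightarrow> b))"

end

theory Submission
  imports Defs
begin

text \<open>
  The minimal center of attraction of \<open>y\<close> consists of the points all of whose neighbourhoods are
  visited by the orbit of \<open>y\<close> at a non-null set of times, so it lies in the orbit closure of \<open>y\<close>.
  Hence an S-generic center \<open>C\<close> is the orbit closure of one of its own points \<open>y\<close>. If \<open>C\<close> is not
  minimal, then it contains the orbit closure \<open>M\<close> of some \<open>w \<in> C\<close> with \<open>y \<notin> M\<close>. The maps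
  of the enveloping semigroup sending \<open>y\<close> into \<open>M\<close> form a nonempty compact right topological
  semigroup, which has an idempotent \<open>u\<close>. The point \<open>z = u y\<close> of \<open>M\<close> satisfies \<open>u z = u y\<close>, so
  it is proximal to \<open>y\<close>; and it is different from \<open>y\<close>, so constant sequences serve for
  \<open>r\<close> and \<open>t\<close>.
\<close>

section \<open>Idempotents in compact right topological semigroups\<close>

text \<open>
  Hausdorffness is a hypothesis and not the class \<open>t2_space\<close>, because the function space has no
  such instance: it would clash with the metric on \<open>'a::countable \<Rightarrow> 'b\<close>.
\<close>

lemma Hausdorff_compact_imp_closed:
  fixes S :: "'a::topological_space set"
  assumes "Hausdorff_space (euclidean :: 'a topology)" "compact S"
  shows "closed S"
  using compactin_imp_closedin[OF assms(1), of S] assms(2) by simp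

text \<open>Finitely many members of a chain have a least one, so the chain has the finite
  intersection property. Hausdorffness makes the members closed, and compactness of one of them
  yields a common point.\<close>

lemma compact_chain_Inter_nonempty:
  fixes \<C> :: "'a::topological_space set set"
  assumes haus: "Hausdorff_space (euclidean :: 'a topology)"
    and ne: "\<C> \<noteq> {}"
    and chain: "\<And>S T. S \<in> \<C> \<Longrightarrow> T \<in> \<C> \<Longrightarrow> S \<subseteq> T \<or> T \<subseteq> S"
    and cpt: "\<And>S. S \<in> \<C> \<Longrightarrow> compact S \<and> S \<noteq> {}"
  shows "\<Inter>\<C> \<noteq> {}"
proof -
  obtain S where S: "S \<in> \<C>" using ne by blast
  have least: "\<exists>T\<in>\<C>. T \<subseteq> S \<inter> \<Inter>\<F>" if "finite \<F>" "\<F> \<subseteq> \<C>" for \<F>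
    using that
  proof (induction \<F>)
    case empty
    then show ?case using S by auto
  next
    case (insert A \<F>)
    then obtain T where "T \<in> \<C>" "T \<subseteq> S \<inter> \<Inter>\<F>" by blast
    moreover have "A \<in> \<C>" using insert.prems by blast
    moreover have "T \<subseteq> A \<or> A \<subseteq> T" using chain calculation by blast
    ultimately show ?case
      by (elim disjE) (rule bexI[of _ T], blast, blast, rule bexI[of _ A], blast, blast)
  qed
  have "S \<inter> \<Inter>\<C> \<noteq> {}"
  proof (rule compact_imp_fip)
    fix \<F> assume "finite \<F>" "\<F> \<subseteq> \<C>"
    with least cpt show "S \<inter> \<Inter>\<F> \<noteq> {}" by (metis subset_empty)
  qed (use S cpt Hausdorff_compact_imp_closed[OF haus] in auto)
  then show ?thesis by blast
qed

text \<open>Zorn's lemma gives a minimal compact subsemigroup \<open>T\<close>. For \<open>u\<close>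
  in \<open>T\<close>, right multiplication by \<open>u\<close> maps \<open>T\<close> onto a compact
  subsemigroup of \<open>T\<close>, and the solutions \<open>p\<close> in \<open>T\<close> of
  \<open>p \<odot> u = u\<close> form another. By minimality both are all of
  \<open>T\<close>.\<close>

theorem ellis_numakura:
  fixes S :: "'a::topological_space set" and mult :: "'a \<Rightarrow> 'a \<Rightarrow> 'a" (infixl "\<odot>" 70)
  assumes haus: "Hausdorff_space (euclidean :: 'a topology)"
    and S: "compact S" "S \<noteq> {}"
    and closed_mult: "\<And>p q. p \<in> S \<Longrightarrow> q \<in> S \<Longrightarrow> p \<odot> q \<in> S"
    and assoc: "\<And>p q r. p \<odot> q \<odot> r = p \<odot> (q \<odot> r)"
    and cont: "\<And>q. q \<in> S \<Longrightarrow> continuous_on S (\<lambda>p. p \<odot> q)"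
  obtains u where "u \<in> S" "u \<odot> u = u"
proof -
  define \<A> where "\<A> = {T. compact T \<and> T \<noteq> {} \<and> T \<subseteq> S \<and> (\<forall>p\<in>T. \<forall>q\<in>T. p \<odot> q \<in> T)}"
  \<comment> \<open>Taking complements turns the maximal element supplied by
    \<open>subset_Zorn_nonempty\<close> into a minimal subsemigroup.\<close>
  have "\<exists>M\<in>uminus ` \<A>. \<forall>X\<in>uminus ` \<A>. M \<subseteq> X \<longrightarrow> X = M"
  proof (rule subset_Zorn_nonempty)
    show "uminus ` \<A> \<noteq> {}" using S closed_mult by (auto simp: \<A>_def)
  next
    fix \<C> :: "'a set set"
    assume ne: "\<C> \<noteq> {}" and ch: "subset.chain (uminus ` \<A>) \<C>"
    define \<D> where "\<D> = uminus ` \<C>"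
    have sub: "\<D> \<subseteq> \<A>" using ch by (auto simp: \<D>_def subset_chain_def)
    have lin: "A \<subseteq> B \<or> B \<subseteq> A" if "A \<in> \<D>" "B \<in> \<D>" for A B
    proof -
      have "- A \<in> \<C>" "- B \<in> \<C>" using that by (auto simp: \<D>_def)
      then have "- A \<subseteq> - B \<or> - B \<subseteq> - A" using ch unfolding subset_chain_def by blast
      then show ?thesis by auto
    qed
    have neD: "\<D> \<noteq> {}" using ne by (simp add: \<D>_def)
    have "\<Inter>\<D> \<noteq> {}"
      by (rule compact_chain_Inter_nonempty) (use haus neD lin sub in \<open>auto simp: \<A>_def\<close>)
    moreover have "\<Inter>\<D> \<subseteq> S" using neD sub by (auto simp: \<A>_def)
    moreover have "compact (\<Inter>\<D>)"
    proof -
      have "closed (\<Inter>\<D>)"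
        using sub by (intro closed_Inter) (auto simp: \<A>_def intro: Hausdorff_compact_imp_closed[OF haus])
      with \<open>\<Inter>\<D> \<subseteq> S\<close> show ?thesis using compact_Int_closed[OF S(1)] by (metis Int_absorb1)
    qed
    moreover have "p \<odot> q \<in> \<Inter>\<D>" if "p \<in> \<Inter>\<D>" "q \<in> \<Inter>\<D>" for p q
      using that sub unfolding \<A>_def by blast
    ultimately have "\<Inter>\<D> \<in> \<A>" unfolding \<A>_def by blast
    moreover have "\<Union>\<C> = - \<Inter>\<D>" by (auto simp: \<D>_def)
    ultimately show "\<Union>\<C> \<in> uminus ` \<A>" by blast
  qed
  then obtain T where T: "T \<in> \<A>" and min: "\<And>X. X \<in> \<A> \<Longrightarrow> X \<subseteq> T \<Longrightarrow> X = T" by auto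
  have T': "compact T" "T \<noteq> {}" "T \<subseteq> S" "\<And>p q. p \<in> T \<Longrightarrow> q \<in> T \<Longrightarrow> p \<odot> q \<in> T"
    using T by (auto simp: \<A>_def)
  obtain u where u: "u \<in> T" using T' by blast
  have contu: "continuous_on T (\<lambda>p. p \<odot> u)"
    using cont u T' continuous_on_subset by blast
  \<comment> \<open>Products stay inside because \<open>(p \<odot> u) \<odot> (q \<odot> u) = (p
    \<odot> u \<odot> q) \<odot> u\<close>.\<close>
  have "(\<lambda>p. p \<odot> u) ` T \<in> \<A>"
    using T' u compact_continuous_image[OF contu] assoc[symmetric] unfolding \<A>_def by auto
  then have "(\<lambda>p. p \<odot> u) ` T = T" using min T' u by blast
  then obtain v where v: "v \<in> T" "v \<odot> u = u" using u by (metis imageE)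
  \<comment> \<open>\<open>v\<close> shows that this set is nonempty; minimality then makes it equal
    to \<open>T\<close>, which puts \<open>u\<close> itself in it.\<close>
  define W where "W = {p \<in> T. p \<odot> u = u}"
  have "W = T \<inter> (\<lambda>p. p \<odot> u) -` {u}" by (auto simp: W_def)
  then have "closed W"
    using continuous_closed_preimage[OF contu] Hausdorff_compact_imp_closed[OF haus] T'(1) by simp
  moreover have "W = T \<inter> W" by (auto simp: W_def)
  ultimately have "compact W" using T'(1) compact_Int_closed by metis
  moreover have "p \<odot> q \<in> W" if "p \<in> W" "q \<in> W" for p q
    using that T' assoc by (auto simp: W_def)
  ultimately have "W \<in> \<A>" using v T' unfolding \<A>_def W_def by blast
  then have "W = T" using min by (auto simp: W_def)
  then have "u \<odot> u = u" using u by (auto simp: W_def)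
  then show thesis using that u T' by blast
qed

section \<open>Separation and compactness of the function space\<close>

lemma Hausdorff_space_fun: "Hausdorff_space (euclidean :: ('a \<Rightarrow> 'b::metric_space) topology)"
  unfolding euclidean_product_topology[symmetric] Hausdorff_space_product_topology
  by simp

text \<open>Tychonoff's theorem, since the topology on functions is the product topology.\<close>

lemma compact_UNIV_fun:
  assumes "compact (UNIV :: 'b::topological_space set)"
  shows "compact (UNIV :: ('a \<Rightarrow> 'b) set)"
proof -
  have "compact_space (product_topology (\<lambda>i::'a. euclidean :: 'b topology) UNIV)"
    using assms by (subst compact_space_product_topology) (simp add: compact_space_def)
  then show ?thesis by (simp add: euclidean_product_topology compact_space_def)
qed

section \<open>Proximality\<close>

text \<open>For \<open>H = \<phi> ` carrier G\<close>, the closure of \<open>H\<close> in the product topology is the Ellis enveloping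
  semigroup of the system.\<close>

lemma closure_compose_closed:
  fixes H :: "('x::t2_space \<Rightarrow> 'x) set"
  assumes cont: "\<And>h. h \<in> H \<Longrightarrow> continuous_on UNIV h"
    and comp: "\<And>h k. h \<in> H \<Longrightarrow> k \<in> H \<Longrightarrow> h \<circ> k \<in> H"
    and p: "p \<in> closure H" and q: "q \<in> closure H"
  shows "p \<circ> q \<in> closure H"
proof -
  \<comment> \<open>Composing with \<open>h\<close> on the left is continuous because
    \<open>h\<close> is; composing with any \<open>r\<close> on the right only permutes or repeats
    coordinates. So the limit is taken first in the right factor, with the left one in
    \<open>H\<close>, and then in the left factor.\<close>
  have left: "continuous_on UNIV (\<lambda>q. h \<circ> q)" if "h \<in> H" for h :: "'x \<Rightarrow> 'x"
    using continuous_on_compose2[OF cont[OF that] continuous_on_product_coordinates]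
    by (intro continuous_on_coordinatewise_then_product) auto
  have right: "continuous_on UNIV (\<lambda>p. p \<circ> r)" for r :: "'x \<Rightarrow> 'x"
    by (intro continuous_on_coordinatewise_then_product) auto
  have hq: "h \<circ> q \<in> closure H" if "h \<in> H" for h
  proof -
    have "(\<lambda>q. h \<circ> q) ` closure H \<subseteq> closure H"
      by (rule image_closure_subset)
        (use continuous_on_subset[OF left[OF that]] comp[OF that] closure_subset in \<open>auto\<close>)
    then show ?thesis using q by blast
  qed
  have "(\<lambda>p. p \<circ> q) ` closure H \<subseteq> closure H"
    by (rule image_closure_subset) (use continuous_on_subset[OF right] hq in auto)
  then show ?thesis using p by blast
qed

text \<open>Two coordinates restrict a function to a basic neighbourhood in the product topology.
  Proximality needs one \<open>h\<close> that works at both points.\<close>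

lemma closure_fun_approx:
  fixes H :: "('a \<Rightarrow> 'x::metric_space) set"
  assumes "u \<in> closure H" "\<epsilon> > 0"
  obtains h where "h \<in> H" "dist (h y) (u y) < \<epsilon>" "dist (h z) (u z) < \<epsilon>"
proof -
  define W where "W = (\<lambda>h::'a \<Rightarrow> 'x. h y) -` ball (u y) \<epsilon> \<inter> (\<lambda>h. h z) -` ball (u z) \<epsilon>"
  have "open W" unfolding W_def by (intro open_Int open_vimage) auto
  moreover have "u \<in> W" using assms by (simp add: W_def)
  ultimately have "W \<inter> H \<noteq> {}"
    using assms(1) open_Int_closure_eq_empty by blast
  then show thesis using that by (auto simp: W_def dist_commute)
qed

text \<open>A version of the Auslander-Ellis theorem for a closed invariant set: an idempotent in
  the closure of \<open>H\<close> does not distinguish \<open>y\<close> from its image.\<close>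

lemma closed_invariant_contains_proximal_point:
  fixes H :: "('x::metric_space \<Rightarrow> 'x) set"
  assumes X: "compact (UNIV :: 'x set)"
    and cont: "\<And>h. h \<in> H \<Longrightarrow> continuous_on UNIV h"
    and comp: "\<And>h k. h \<in> H \<Longrightarrow> k \<in> H \<Longrightarrow> h \<circ> k \<in> H"
    and M: "closed M" "\<And>h. h \<in> H \<Longrightarrow> h ` M \<subseteq> M"
    and meets: "M \<inter> closure ((\<lambda>h. h y) ` H) \<noteq> {}"
  obtains z where "z \<in> M" "\<And>\<epsilon>. \<epsilon> > 0 \<Longrightarrow> \<exists>h\<in>H. dist (h y) (h z) < \<epsilon>"
proof -
  define L where "L = closure H \<inter> (\<lambda>p. p y) -` M"
  have ev: "continuous_on S (\<lambda>p::'x \<Rightarrow> 'x. p v)" for S v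
    by (rule continuous_on_subset[OF continuous_on_product_coordinates]) simp
  have compact_cl: "compact (closure H)"
    using compact_Int_closed[OF compact_UNIV_fun[OF X] closed_closure[of H]] by simp
  \<comment> \<open>Evaluation at \<open>y\<close> has a compact, hence closed, image. Every point
    of the orbit closure is therefore a value \<open>p y\<close>, and \<open>meets\<close> provides
    an element of \<open>L\<close>.\<close>
  have "closure ((\<lambda>h. h y) ` H) \<subseteq> (\<lambda>p. p y) ` closure H"
    by (intro closure_minimal image_mono closure_subset compact_imp_closed
        compact_continuous_image ev compact_cl)
  with meets have ne: "L \<noteq> {}" by (auto simp: L_def)
  \<comment> \<open>Invariance survives pointwise limits as \<open>M\<close> is closed. It makes
    \<open>L\<close> a semigroup: \<open>q y\<close> is in \<open>M\<close>, and \<open>p\<close>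
    keeps it there.\<close>
  have inv: "p v \<in> M" if "p \<in> closure H" "v \<in> M" for p v
  proof -
    have "(\<lambda>p. p v) ` H \<subseteq> M" using M(2) that(2) by blast
    then have "(\<lambda>p. p v) ` closure H \<subseteq> M" by (rule image_closure_subset[OF ev M(1)])
    then show ?thesis using that by blast
  qed
  have "closed ((\<lambda>p::'x \<Rightarrow> 'x. p y) -` M)"
    using M(1) by (intro closed_vimage) auto
  then have "compact L" unfolding L_def using compact_cl by blast
  then obtain u where u: "u \<in> L" "u \<circ> u = u"
  proof (rule ellis_numakura[OF Hausdorff_space_fun, where mult = "(\<circ>)"])
    show "p \<circ> q \<in> L" if "p \<in> L" "q \<in> L" for p q
      using that inv closure_compose_closed[OF cont comp] by (auto simp: L_def)
    show "continuous_on L (\<lambda>p. p \<circ> q)" for q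
      by (intro continuous_on_coordinatewise_then_product) (simp add: ev)
  qed (use ne in \<open>auto simp: comp_assoc\<close>)
  \<comment> \<open>\<open>u\<close> takes the same value \<open>u y\<close> at \<open>y\<close> and
    at \<open>u y\<close>, so an \<open>h\<close> close to \<open>u\<close> at both points brings
    their images together.\<close>
  have "\<exists>h\<in>H. dist (h y) (h (u y)) < \<epsilon>" if "\<epsilon> > 0" for \<epsilon>
  proof -
    have "u \<in> closure H" "\<epsilon>/2 > 0" using u(1) that by (auto simp: L_def)
    then obtain h where h: "h \<in> H" "dist (h y) (u y) < \<epsilon>/2" "dist (h (u y)) (u (u y)) < \<epsilon>/2"
      by (rule closure_fun_approx)
    have "u (u y) = u y" using fun_cong[OF u(2), of y] by simp
    then have "dist (h y) (h (u y)) < \<epsilon>" using h(2,3) by (simp add: dist_triangle_half_l)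
    then show ?thesis using h(1) by blast
  qed
  moreover have "u y \<in> M" using u(1) by (simp add: L_def)
  ultimately show thesis using that by blast
qed

section \<open>Null sets and the minimal center of attraction\<close>

text \<open>Upper density zero, stated by eventual bounds instead of a supremum, so that subsets and
  finite unions are easy to handle.\<close>

definition null_set ::
    "'n set \<Rightarrow> ('n \<Rightarrow> 'n \<Rightarrow> bool) \<Rightarrow> ('n \<Rightarrow> 'g set) \<Rightarrow> 'g set \<Rightarrow> bool" where
  "null_set D R F A \<longleftrightarrow>
     (\<forall>e>0. \<exists>m\<in>D. \<forall>n\<in>D. R m n \<longrightarrow> real (card (A \<inter> F n)) / real (card (F n)) \<le> e)"

locale finite_set_net =
  fixes D :: "'n set" and R :: "'n \<Rightarrow> 'n \<Rightarrow> bool" and F :: "'n \<Rightarrow> 'g set"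
  assumes directed: "directed_set D R"
    and fin: "n \<in> D \<Longrightarrow> finite (F n)"
    and nonempty: "n \<in> D \<Longrightarrow> F n \<noteq> {}"
begin

lemma D_nonempty: "D \<noteq> {}"
  using directed by (simp add: directed_set_def)

lemma ratio_le_one: "n \<in> D \<Longrightarrow> real (card (A \<inter> F n)) / real (card (F n)) \<le> 1"
  using fin[of n] card_mono[of "F n" "A \<inter> F n"] by (auto simp: divide_le_eq_1)

lemma ratio_complement:
  assumes "n \<in> D"
  shows "real (card (- A \<inter> F n)) / real (card (F n)) = 1 - real (card (A \<inter> F n)) / real (card (F n))"
proof -
  have "card (F n) = card (A \<inter> F n) + card (- A \<inter> F n)"
    using fin[OF assms] by (subst card_Un_disjoint[symmetric]) (auto intro: arg_cong[where f = card])
  then have "real (card (- A \<inter> F n)) = real (card (F n)) - real (card (A \<inter> F n))" by linarith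
  then show ?thesis using fin[OF assms] nonempty[OF assms] by (simp add: diff_divide_distrib)
qed

lemma tail_Int:
  assumes "m \<in> D" "k \<in> D"
  obtains l where "l \<in> D" "\<And>n. n \<in> D \<Longrightarrow> R l n \<Longrightarrow> R m n \<and> R k n"
  using directed assms unfolding directed_set_def transp_on_def by metis

lemma null_set_empty: "null_set D R F {}"
  using D_nonempty by (auto simp: null_set_def)

text \<open>The ratios see only the union of the \<open>F n\<close>, so the inclusion is tested
  there. This allows complements in the whole type to be exchanged for complements in
  \<open>carrier G\<close>.\<close>

lemma null_set_mono:
  assumes "null_set D R F B" "A \<inter> (\<Union>n\<in>D. F n) \<subseteq> B"
  shows "null_set D R F A"
proof -
  have "real (card (A \<inter> F n)) / real (card (F n)) \<le> real (card (B \<inter> F n)) / real (card (F n))"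
    if "n \<in> D" for n
    using that assms(2) fin[OF that] by (intro divide_right_mono of_nat_mono card_mono) auto
  then show ?thesis using assms(1) unfolding null_set_def by (meson order_trans)
qed

lemma null_set_Un:
  assumes "null_set D R F A" "null_set D R F B"
  shows "null_set D R F (A \<union> B)"
  unfolding null_set_def
proof (intro allI impI)
  fix e :: real assume "e > 0"
  then have e: "e/2 > 0" by simp
  obtain m where m: "m \<in> D" "\<And>n. n \<in> D \<Longrightarrow> R m n \<Longrightarrow> real (card (A \<inter> F n)) / real (card (F n)) \<le> e/2"
    using assms(1)[unfolded null_set_def, rule_format, OF e] by blast
  obtain k where k: "k \<in> D" "\<And>n. n \<in> D \<Longrightarrow> R k n \<Longrightarrow> real (card (B \<inter> F n)) / real (card (F n)) \<le> e/2"
    using assms(2)[unfolded null_set_def, rule_format, OF e] by blast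
  obtain l where l: "l \<in> D" "\<And>n. n \<in> D \<Longrightarrow> R l n \<Longrightarrow> R m n \<and> R k n"
    using tail_Int m(1) k(1) by metis
  have "real (card ((A \<union> B) \<inter> F n)) / real (card (F n)) \<le> e" if "n \<in> D" "R l n" for n
  proof -
    have "real (card ((A \<union> B) \<inter> F n)) \<le> real (card (A \<inter> F n)) + real (card (B \<inter> F n))"
      using card_Un_le[of "A \<inter> F n" "B \<inter> F n"] by (simp add: Int_Un_distrib2)
    then have "real (card ((A \<union> B) \<inter> F n)) / real (card (F n))
        \<le> real (card (A \<inter> F n)) / real (card (F n)) + real (card (B \<inter> F n)) / real (card (F n))"
      by (simp add: divide_right_mono flip: add_divide_distrib)
    also have "\<dots> \<le> e/2 + e/2" using l(2)[OF that] by (intro add_mono m(2) k(2) that(1)) auto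
    finally show ?thesis by simp
  qed
  then show "\<exists>m\<in>D. \<forall>n\<in>D. R m n \<longrightarrow> real (card ((A \<union> B) \<inter> F n)) / real (card (F n)) \<le> e"
    using l(1) by blast
qed

lemma null_set_UN:
  "finite I \<Longrightarrow> (\<And>i. i \<in> I \<Longrightarrow> null_set D R F (A i)) \<Longrightarrow> null_set D R F (\<Union>i\<in>I. A i)"
  by (induction I rule: finite_induct) (auto simp: null_set_empty null_set_Un)

text \<open>The lower density is at most the upper one, which is at most 1. Density 1 thus says that
  each \<open>1 - e\<close> is an eventual lower bound of the ratio, and the complement has one
  minus that ratio.\<close>

lemma has_density_1_iff: "has_density D R F A 1 \<longleftrightarrow> null_set D R F (- A)"
proof -
  define ratio where "ratio n = real (card (A \<inter> F n)) / real (card (F n))" for n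
  define lo where "lo = {\<alpha>. \<exists>m\<in>D. \<forall>n\<in>D. R m n \<longrightarrow> ratio n \<ge> \<alpha>}"
  define up where "up = {\<alpha>. \<forall>m\<in>D. \<exists>n\<in>D. R m n \<and> ratio n \<ge> \<alpha>}"
  have "0 \<in> lo"
    using D_nonempty by (auto simp: lo_def ratio_def)
  then have lo_ne: "lo \<noteq> {}" by blast
  have lo_up: "lo \<subseteq> up"
  proof
    fix \<alpha> assume "\<alpha> \<in> lo"
    then obtain k where k: "k \<in> D" "\<And>n. n \<in> D \<Longrightarrow> R k n \<Longrightarrow> ratio n \<ge> \<alpha>" by (auto simp: lo_def)
    have "\<exists>n\<in>D. R m n \<and> ratio n \<ge> \<alpha>" if "m \<in> D" for m
      using directed k that unfolding directed_set_def by meson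
    then show "\<alpha> \<in> up" by (simp add: up_def)
  qed
  have up_le: "\<alpha> \<le> 1" if "\<alpha> \<in> up" for \<alpha>
  proof -
    obtain m where "m \<in> D" using D_nonempty by blast
    then obtain n where "n \<in> D" "\<alpha> \<le> ratio n" using \<open>\<alpha> \<in> up\<close> by (auto simp: up_def)
    then show ?thesis using ratio_le_one[of n A] by (simp add: ratio_def)
  qed
  have bdd: "bdd_above up" using up_le by (meson bdd_aboveI)
  have bdd_lo: "bdd_above lo" by (rule bdd_above_mono[OF bdd lo_up])
  have le: "Sup lo \<le> Sup up" using cSup_subset_mono[OF lo_ne bdd lo_up] .
  have up1: "Sup up \<le> 1" using up_le lo_ne lo_up by (intro cSup_least) auto
  have "has_density D R F A 1 \<longleftrightarrow> Sup up = 1 \<and> Sup lo = 1"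
    by (simp add: has_density_def upper_density_def lower_density_def lo_def up_def ratio_def)
  also have "\<dots> \<longleftrightarrow> Sup lo \<ge> 1" using le up1 by linarith
  also have "\<dots> \<longleftrightarrow> (\<forall>e>0. 1 - e \<in> lo)"
  proof
    assume *: "Sup lo \<ge> 1"
    show "\<forall>e>0. 1 - e \<in> lo"
    \<comment> \<open>\<open>lo\<close> is closed downwards, so any member above
      \<open>1 - e\<close> suffices.\<close>
    proof (intro allI impI)
      fix e :: real assume "e > 0"
      then obtain \<alpha> where "\<alpha> \<in> lo" "1 - e < \<alpha>"
        using * less_cSup_iff[OF lo_ne bdd_lo, of "1 - e"] by auto
      then show "1 - e \<in> lo" unfolding lo_def by force
    qed
  next
    assume *: "\<forall>e>0. 1 - e \<in> lo"
    have "1 \<le> Sup lo + e" if "e > 0" for e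
      using cSup_upper[OF _ bdd_lo, of "1 - e"] * that by force
    then show "Sup lo \<ge> 1" using field_le_epsilon by blast
  qed
  also have "\<dots> \<longleftrightarrow> null_set D R F (- A)"
    unfolding null_set_def lo_def by (simp add: ratio_complement ratio_def algebra_simps cong: ball_cong conj_cong imp_cong)
  finally show ?thesis .
qed

end

text \<open>An explicit candidate for the definite description \<open>min_center\<close>, identified
  with it in \<open>min_center_eq\<close>.\<close>

definition recurrent_limit_set ::
    "('g, 'm) monoid_scheme \<Rightarrow> ('g \<Rightarrow> 'x::metric_space \<Rightarrow> 'x) \<Rightarrow>
     'n set \<Rightarrow> ('n \<Rightarrow> 'n \<Rightarrow> bool) \<Rightarrow> ('n \<Rightarrow> 'g set) \<Rightarrow> 'x \<Rightarrow> 'x set" where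
  "recurrent_limit_set G \<phi> D R F x =
     {z. \<forall>\<epsilon>>0. \<not> null_set D R F {g \<in> carrier G. \<phi> g x \<in> ball z \<epsilon>}}"

context
  fixes G :: "('g, 'm) monoid_scheme" and \<phi> :: "'g \<Rightarrow> 'x::metric_space \<Rightarrow> 'x"
    and D :: "'n set" and R :: "'n \<Rightarrow> 'n \<Rightarrow> bool" and F :: "'n \<Rightarrow> 'g set"
  assumes net: "finite_set_net D R F"
    and carrier: "\<And>n. n \<in> D \<Longrightarrow> F n \<subseteq> carrier G"
begin

interpretation finite_set_net D R F by (rule net)

lemma center_of_attraction_iff:
  "center_of_attraction G \<phi> D R F x C \<longleftrightarrow>
     closed C \<and> (\<forall>\<epsilon>>0. null_set D R F {g \<in> carrier G. \<phi> g x \<notin> (\<Union>c\<in>C. ball c \<epsilon>)})"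
proof -
  have "null_set D R F (- {g \<in> carrier G. P g}) \<longleftrightarrow> null_set D R F {g \<in> carrier G. \<not> P g}" for P
    using carrier by (auto elim!: null_set_mono)
  then show ?thesis by (simp add: center_of_attraction_def has_density_1_iff)
qed

lemma closed_recurrent_limit_set: "closed (recurrent_limit_set G \<phi> D R F x)"
proof -
  have "\<exists>e>0. ball z e \<subseteq> - recurrent_limit_set G \<phi> D R F x"
    if z: "z \<in> - recurrent_limit_set G \<phi> D R F x" for z
  proof -
    obtain \<epsilon> where \<epsilon>: "\<epsilon> > 0" "null_set D R F {g \<in> carrier G. \<phi> g x \<in> ball z \<epsilon>}"
      using z by (auto simp: recurrent_limit_set_def)
    have "null_set D R F {g \<in> carrier G. \<phi> g x \<in> ball w (\<epsilon>/2)}" if "dist z w < \<epsilon>/2" for w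
    proof -
      have "ball w (\<epsilon>/2) \<subseteq> ball z \<epsilon>"
        using that by (metis dist_commute dist_triangle_half_r mem_ball subsetI)
      then show ?thesis by (intro null_set_mono[OF \<epsilon>(2)]) auto
    qed
    then have "ball z (\<epsilon>/2) \<subseteq> - recurrent_limit_set G \<phi> D R F x"
      using half_gt_zero[OF \<epsilon>(1)] unfolding recurrent_limit_set_def by fastforce
    then show ?thesis using half_gt_zero[OF \<epsilon>(1)] by blast
  qed
  then show ?thesis unfolding closed_def open_contains_ball by blast
qed

text \<open>A point off the closed set \<open>C\<close> has a ball disjoint from \<open>C\<close>.
  Visits to the ball of half the radius avoid the neighbourhood of \<open>C\<close> of that half
  radius, so they form a null set.\<close>

lemma recurrent_limit_set_subset_center:
  assumes "center_of_attraction G \<phi> D R F x C"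
  shows "recurrent_limit_set G \<phi> D R F x \<subseteq> C"
proof
  fix z assume z: "z \<in> recurrent_limit_set G \<phi> D R F x"
  show "z \<in> C"
  proof (rule ccontr)
    assume "z \<notin> C"
    then obtain \<epsilon> where \<epsilon>: "\<epsilon> > 0" "ball z \<epsilon> \<subseteq> - C"
      using assms unfolding center_of_attraction_def closed_def open_contains_ball by blast
    have "w \<notin> (\<Union>c\<in>C. ball c (\<epsilon>/2))" if "w \<in> ball z (\<epsilon>/2)" for w
    proof
      assume "w \<in> (\<Union>c\<in>C. ball c (\<epsilon>/2))"
      then obtain c where "c \<in> C" "dist c w < \<epsilon>/2" by auto
      moreover from this that have "dist z c < \<epsilon>"
        by (metis dist_commute dist_triangle_half_l mem_ball)
      ultimately show False using \<epsilon>(2) by auto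
    qed
    moreover have "null_set D R F {g \<in> carrier G. \<phi> g x \<notin> (\<Union>c\<in>C. ball c (\<epsilon>/2))}"
      using assms half_gt_zero[OF \<epsilon>(1)] unfolding center_of_attraction_iff by blast
    ultimately have "null_set D R F {g \<in> carrier G. \<phi> g x \<in> ball z (\<epsilon>/2)}"
      by (rule_tac null_set_mono) auto
    then show False using z \<epsilon>(1) half_gt_zero unfolding recurrent_limit_set_def by blast
  qed
qed

text \<open>Off an open neighbourhood of the set, each point has a ball visited at a null set of
  times. By compactness finitely many such balls cover the rest, and a finite union of null sets is
  null.\<close>

lemma center_of_attraction_recurrent_limit_set:
  assumes "compact (UNIV :: 'x set)"
  shows "center_of_attraction G \<phi> D R F x (recurrent_limit_set G \<phi> D R F x)"
proof -
  let ?K = "recurrent_limit_set G \<phi> D R F x"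
  have "null_set D R F {g \<in> carrier G. \<phi> g x \<notin> (\<Union>c\<in>?K. ball c \<epsilon>)}" if "\<epsilon> > 0" for \<epsilon>
  proof -
    define Y where "Y = - (\<Union>c\<in>?K. ball c \<epsilon>)"
    have "closed Y" unfolding Y_def by (intro closed_Compl open_UN) auto
    then have "compact Y" using compact_Int_closed[OF assms, of Y] by simp
    have "\<exists>r>0. null_set D R F {g \<in> carrier G. \<phi> g x \<in> ball z r}" if "z \<in> Y" for z
      using that \<open>\<epsilon> > 0\<close> by (auto simp: Y_def recurrent_limit_set_def)
    then obtain r where r: "\<And>z. z \<in> Y \<Longrightarrow> r z > 0 \<and> null_set D R F {g \<in> carrier G. \<phi> g x \<in> ball z (r z)}"
      by metis
    have "Y \<subseteq> (\<Union>z\<in>Y. ball z (r z))" using r by force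
    then obtain Z where Z: "Z \<subseteq> Y" "finite Z" "Y \<subseteq> (\<Union>z\<in>Z. ball z (r z))"
      using compactE_image[OF \<open>compact Y\<close>, of Y "\<lambda>z. ball z (r z)"] by auto
    have "null_set D R F (\<Union>z\<in>Z. {g \<in> carrier G. \<phi> g x \<in> ball z (r z)})"
      using Z r by (intro null_set_UN) auto
    then show ?thesis by (rule null_set_mono) (use Z(3) in \<open>unfold Y_def, blast\<close>)
  qed
  then show ?thesis by (simp add: center_of_attraction_iff closed_recurrent_limit_set)
qed

text \<open>The set is a center contained in every other center, which gives minimality and
  uniqueness at once.\<close>

lemma min_center_eq:
  assumes "compact (UNIV :: 'x set)"
  shows "min_center G \<phi> D R F x = recurrent_limit_set G \<phi> D R F x"
  unfolding min_center_def
proof (rule the_equality)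
  note K = center_of_attraction_recurrent_limit_set[OF assms, of x]
  show "center_of_attraction G \<phi> D R F x (recurrent_limit_set G \<phi> D R F x) \<and>
      (\<forall>C'. C' \<subset> recurrent_limit_set G \<phi> D R F x \<longrightarrow> \<not> center_of_attraction G \<phi> D R F x C')"
    using K recurrent_limit_set_subset_center by blast
  show "C = recurrent_limit_set G \<phi> D R F x"
    if "center_of_attraction G \<phi> D R F x C \<and>
      (\<forall>C'. C' \<subset> C \<longrightarrow> \<not> center_of_attraction G \<phi> D R F x C')" for C
    using that K recurrent_limit_set_subset_center by blast
qed

text \<open>The empty set is null, so a non-null set of visits contains at least one.\<close>

lemma recurrent_limit_set_subset_closure_orbit:
  "recurrent_limit_set G \<phi> D R F x \<subseteq> closure (orbit G \<phi> x)"
proof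
  fix z assume z: "z \<in> recurrent_limit_set G \<phi> D R F x"
  have "\<exists>y\<in>orbit G \<phi> x. dist y z < \<epsilon>" if "\<epsilon> > 0" for \<epsilon>
  proof (rule ccontr)
    assume "\<not> ?thesis"
    then have "{g \<in> carrier G. \<phi> g x \<in> ball z \<epsilon>} = {}" by (auto simp: orbit_def dist_commute)
    then show False using z that null_set_empty unfolding recurrent_limit_set_def
      by (metis (mono_tags, lifting) mem_Collect_eq)
  qed
  then show "z \<in> closure (orbit G \<phi> x)" by (simp add: closure_approachable)
qed

end

section \<open>Chaotic pairs\<close>

lemma F_chaotic_pairI:
  assumes act: "group_action G UNIV \<phi>"
    and z: "z \<in> closure (orbit G \<phi> y)" and "y \<noteq> z"
    and prox: "\<And>\<epsilon>. \<epsilon> > 0 \<Longrightarrow> \<exists>g\<in>carrier G. dist (\<phi> g y) (\<phi> g z) < \<epsilon>"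
  shows "F_chaotic_pair G \<phi> y z"
proof -
  interpret group_action G UNIV \<phi> by (rule act)
  interpret group G using group_hom group_hom.axioms(1) by auto
  \<comment> \<open>\<open>id_eq_one\<close> describes the identity map restricted to the phase
    space; on \<open>UNIV\<close> the restriction disappears.\<close>
  have one: "\<phi> \<one>\<^bsub>G\<^esub> v = v" for v by (metis UNIV_I id_eq_one restrict_apply')
  have "\<forall>n. \<exists>g\<in>carrier G. dist (\<phi> g y) z < inverse (real (Suc n))"
    using z unfolding closure_approachable orbit_def
    by (smt (verit) inverse_positive_iff_positive mem_Collect_eq of_nat_0_less_iff zero_less_Suc)
  then obtain l where l: "\<And>n. l n \<in> carrier G" "\<And>n. dist (\<phi> (l n) y) z < inverse (real (Suc n))"
    by metis
  have "\<forall>n. \<exists>g\<in>carrier G. dist (\<phi> g y) (\<phi> g z) < inverse (real (Suc n))"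
    using prox by simp
  then obtain s where s: "\<And>n. s n \<in> carrier G"
    "\<And>n. dist (\<phi> (s n) y) (\<phi> (s n) z) < inverse (real (Suc n))"
    by metis
  have "(\<lambda>n. dist (\<phi> (l n) y) z) \<longlonglongrightarrow> 0"
    by (rule tendsto_sandwich[OF _ _ tendsto_const LIMSEQ_inverse_real_of_nat])
      (use l in \<open>auto intro!: always_eventually less_imp_le simp del: of_nat_Suc\<close>)
  moreover have "(\<lambda>n. dist (\<phi> (s n) y) (\<phi> (s n) z)) \<longlonglongrightarrow> 0"
    by (rule tendsto_sandwich[OF _ _ tendsto_const LIMSEQ_inverse_real_of_nat])
      (use s in \<open>auto intro!: always_eventually less_imp_le simp del: of_nat_Suc\<close>)
  ultimately show ?thesis
    unfolding F_chaotic_pair_def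
    \<comment> \<open>With the identity element at every time for \<open>r\<close> and
      \<open>t\<close>, both limits are \<open>dist y z\<close>, positive since \<open>y\<close> and
      \<open>z\<close> differ.\<close>
    by (intro exI[of _ l] exI[of _ "\<lambda>_. \<one>\<^bsub>G\<^esub>"] exI[of _ s] exI[of _ "dist y z"] conjI)
      (use l s \<open>y \<noteq> z\<close> one in auto)
qed

lemma orbit_closure_invariant:
  assumes "group_action G UNIV \<phi>" "\<And>g. g \<in> carrier G \<Longrightarrow> continuous_on UNIV (\<phi> g)"
    and "g \<in> carrier G"
  shows "\<phi> g ` closure (orbit G \<phi> x) \<subseteq> closure (orbit G \<phi> x)"
proof (rule image_closure_subset)
  interpret group_action G UNIV \<phi> by (rule assms(1))
  interpret group G using group_hom group_hom.axioms(1) by auto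
  have "\<phi> g ` orbit G \<phi> x \<subseteq> orbit G \<phi> x"
  proof
    fix v assume "v \<in> \<phi> g ` orbit G \<phi> x"
    then obtain h where "h \<in> carrier G" "v = \<phi> g (\<phi> h x)" by (auto simp: orbit_def)
    then have "v = \<phi> (g \<otimes>\<^bsub>G\<^esub> h) x" "g \<otimes>\<^bsub>G\<^esub> h \<in> carrier G"
      using assms(3) composition_rule by auto
    then show "v \<in> orbit G \<phi> x" by (auto simp: orbit_def)
  qed
  then show "\<phi> g ` orbit G \<phi> x \<subseteq> closure (orbit G \<phi> x)" using closure_subset by blast
  show "continuous_on (closure (orbit G \<phi> x)) (\<phi> g)"
    using assms(2,3) continuous_on_subset by blast
qed simp

theorem theorem1p3:
  fixes G :: "('g, 'm) monoid_scheme"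
    and \<phi> :: "'g \<Rightarrow> 'x::metric_space \<Rightarrow> 'x"
    and D :: "'n set" and R :: "'n \<Rightarrow> 'n \<Rightarrow> bool" and F :: "'n \<Rightarrow> 'g set"
    and x :: 'x
  assumes "G_system G \<phi>"
    and "folner_net G D R F"
    and "S_generic G \<phi> D R F (min_center G \<phi> D R F x)"
    and "\<not> minimal_subset G \<phi> (min_center G \<phi> D R F x)"
  shows "\<exists>y z. y \<in> min_center G \<phi> D R F x \<and> z \<in> min_center G \<phi> D R F x \<and>
           F_chaotic_pair G \<phi> y z"
proof -
  define C where "C = min_center G \<phi> D R F x"
  have X: "compact (UNIV :: 'x set)" and act: "group_action G UNIV \<phi>"
    and cont: "\<And>g. g \<in> carrier G \<Longrightarrow> continuous_on UNIV (\<phi> g)"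
    using assms(1) by (auto simp: G_system_def)
  interpret group_action G UNIV \<phi> by (rule act)
  interpret group G using group_hom group_hom.axioms(1) by auto
  have net: "finite_set_net D R F" "\<And>n. n \<in> D \<Longrightarrow> F n \<subseteq> carrier G"
    using assms(2) by (auto simp: folner_net_def finite_set_net_def)
  note center = min_center_eq[OF net X, where \<phi> = \<phi>]
  obtain y where y: "y \<in> C" "C = min_center G \<phi> D R F y" and inv: "G_invariant G \<phi> C"
    using assms(3) by (auto simp: S_generic_def C_def)
  have "closed C" using closed_recurrent_limit_set[OF net] center by (simp add: C_def)
  \<comment> \<open>Together with \<open>orbit_C\<close> this makes \<open>C\<close> the orbit
    closure of its own point \<open>y\<close>.\<close>
  have C_sub: "C \<subseteq> closure (orbit G \<phi> y)"
    using recurrent_limit_set_subset_closure_orbit[OF net] center y(2) by simp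
  have orbit_C: "closure (orbit G \<phi> w) \<subseteq> C" if "w \<in> C" for w
    using inv that \<open>closed C\<close> by (intro closure_minimal) (auto simp: G_invariant_def orbit_def)
  \<comment> \<open>\<open>C\<close> is nonempty, closed and invariant, so minimality can fail only
    through an orbit that is not dense in \<open>C\<close>.\<close>
  obtain w where w: "w \<in> C" "\<not> C \<subseteq> closure (orbit G \<phi> w)"
    using assms(4) y(1) \<open>closed C\<close> inv by (auto simp: minimal_subset_def C_def[symmetric])
  define M where "M = closure (orbit G \<phi> w)"
  have M_inv: "\<phi> g ` M \<subseteq> M" if "g \<in> carrier G" for g
    unfolding M_def using orbit_closure_invariant[OF act cont that] .
  have "y \<notin> M"
  proof
    assume "y \<in> M"
    then have "orbit G \<phi> y \<subseteq> M" using M_inv by (auto simp: orbit_def)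
    then have "closure (orbit G \<phi> y) \<subseteq> M" by (simp add: M_def closure_minimal)
    then show False using C_sub w(2) by (auto simp: M_def)
  qed
  have "w \<in> M" using orbit_refl[of w] closure_subset by (auto simp: M_def)
  \<comment> \<open>The common point is \<open>w\<close>: it lies in \<open>C\<close>, hence in the
    orbit closure of \<open>y\<close>.\<close>
  then have meets: "M \<inter> closure ((\<lambda>h. h y) ` \<phi> ` carrier G) \<noteq> {}"
    using w(1) C_sub by (auto simp: orbit_def image_image Setcompr_eq_image)
  obtain z where z: "z \<in> M"
    and prox: "\<And>\<epsilon>. \<epsilon> > 0 \<Longrightarrow> \<exists>h\<in>\<phi> ` carrier G. dist (h y) (h z) < \<epsilon>"
  proof (rule closed_invariant_contains_proximal_point[OF X _ _ _ _ meets])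
    fix h k assume "h \<in> \<phi> ` carrier G" "k \<in> \<phi> ` carrier G"
    then obtain a b where ab: "h = \<phi> a" "k = \<phi> b" "a \<in> carrier G" "b \<in> carrier G" by auto
    then have "h \<circ> k = \<phi> (a \<otimes>\<^bsub>G\<^esub> b)" using composition_rule by (auto simp: fun_eq_iff)
    then show "h \<circ> k \<in> \<phi> ` carrier G" using ab by blast
  next
    show "h ` M \<subseteq> M" if "h \<in> \<phi> ` carrier G" for h using M_inv that by blast
  qed (use cont in \<open>auto simp: M_def\<close>)
  have "z \<in> C" using z orbit_C[OF w(1)] by (auto simp: M_def)
  moreover have "F_chaotic_pair G \<phi> y z"
    \<comment> \<open>\<open>y\<close> and \<open>z\<close> differ because \<open>M\<close> contains
      \<open>z\<close> but not \<open>y\<close>.\<close>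
    by (rule F_chaotic_pairI[OF act]) (use \<open>z \<in> C\<close> C_sub z \<open>y \<notin> M\<close> prox in auto)
  ultimately show ?thesis using y(1) unfolding C_def by blast
qed

end
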